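(* The congested location problem (defined in the context) can be transformed to the following mixed-integer second-order cone program in the variables $x=(x_{ik})$, $y=(y_{ikj})$ and real variables $s=(s_{ik})$, $t=(t_{ik})$ $(i\in I,k\in K,j\in J)$: $$\min\ \sum_{i\in I}\sum_{k\in K}f_{ik}x_{ik}+\sum_{i\in I}\sum_{k\in K}\left[\frac{w_i(1+\mu_{ik}^2\sigma_{ik}^2)\,s_{ik}}{2}+\frac{w_i(1-\mu_{ik}^2\sigma_{ik}^2)\sum_{j\in J}\lambda_jy_{ikj}}{2\mu_{ik}}\right]+\sum_{i\in I}\sum_{k\in K}\sum_{j\in J}d_{ij}\lambda_jy_{ikj}$$ subject to $$2\sum_{j\in J}\lambda_jy_{ikj}^2+s_{ik}^2+t_{ik}^2\le(s_{ik}+t_{ik})^2,\quad t_{ik}=\mu_{ik}-\sum_{j\in J}\lambda_jy_{ikj},\quad t_{ik}\ge0,\quad s_{ik}\ge0\qquad(i\in I,\ k\in K),$$ $$\sum_{i\in I}\sum_{k\in K}y_{ikj}=1\ (j\in J),\quad y_{ikj}\le x_{ik}\ (i\in I,k\in K,j\in J),\quad \sum_{k\in K}x_{ik}\le1\ (i\in I),\quad \sum_{j\in J}\lambda_jy_{ikj}\le\mu_{ik}\ (i\in I,k\in K),$$ $$x_{ik}\in\{0,1\}\ (i\in I,k\in K),\quad y_{ikj}\in\{0,1\}\ (i\in I,k\in K,j\in J).$$ That is, the two problems have the same optimal value, and $(x,y)$ is optimal for the congested location problem if and only if there exist $s,t$ such that $(x,y,s,t)$ is optimal for this program.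
   Context: Let $I,J,K$ be finite sets (facilities, customers, service-capacity levels). Parameters: real costs $f_{ik}$ and $d_{ij}$, demand rates $\lambda_j\ge0$, service rates $\mu_{ik}>0$, service-time standard deviations $\sigma_{ik}\ge0$, and waiting costs $w_i\ge0$ $(i\in I,j\in J,k\in K)$. The congested location problem is $$\min\ \sum_{i\in I}\sum_{k\in K}f_{ik}x_{ik}+\sum_{i\in I}\sum_{k\in K}w_i\,TW_{ik}+\sum_{i\in I}\sum_{k\in K}\sum_{j\in J}d_{ij}\lambda_jy_{ikj}$$ subject to $\sum_{i\in I}\sum_{k\in K}y_{ikj}=1$ $(j\in J)$; $y_{ikj}\le x_{ik}$ $(i\in I,k\in K,j\in J)$; $\sum_{k\in K}x_{ik}\le1$ $(i\in I)$; $\sum_{j\in J}\lambda_jy_{ikj}\le\mu_{ik}$ $(i\in I,k\in K)$; $x_{ik}\in\{0,1\}$ and $y_{ikj}\in\{0,1\}$ for all $i,k,j$; where $$TW_{ik}=\frac{\big(\sum_{j\in J}\lambda_jy_{ikj}\big)^2(1+\mu_{ik}^2\sigma_{ik}^2)}{2\mu_{ik}\big(\mu_{ik}-\sum_{j\in J}\lambda_jy_{ikj}\big)}+\frac{\sum_{j\in J}\lambda_jy_{ikj}}{\mu_{ik}}$$ is the expected total waiting at an M/G/1 facility. By the stability assumption on queues, points with $\sum_{j\in J}\lambda_jy_{ikj}=\mu_{ik}$ for some $(i,k)$ are regarded as infeasible. The optimal value of an infeasible problem is $+\infty$. *)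

theory Defs
  imports Complex_Main "HOL-Library.Extended_Real"
begin

record ('i, 'j, 'k) clp_instance =
  facilities :: "'i set"
  customers :: "'j set"
  capacities :: "'k set"
  fixed_cost :: "'i \<Rightarrow> 'k \<Rightarrow> real"
  travel_cost :: "'i \<Rightarrow> 'j \<Rightarrow> real"
  demand :: "'j \<Rightarrow> real"
  service_rate :: "'i \<Rightarrow> 'k \<Rightarrow> real"
  service_sd :: "'i \<Rightarrow> 'k \<Rightarrow> real"
  waiting_cost :: "'i \<Rightarrow> real"

text \<open>Decision variables are total functions; the constraints and objectives below
  only read their values on the index sets of the instance.\<close>

type_synonym ('i, 'k) xvar = "'i \<Rightarrow> 'k \<Rightarrow> real"
type_synonym ('i, 'j, 'k) yvar = "'i \<Rightarrow> 'k \<Rightarrow> 'j \<Rightarrow> real"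

definition load :: "('i, 'j, 'k) clp_instance \<Rightarrow> ('i, 'j, 'k) yvar \<Rightarrow> 'i \<Rightarrow> 'k \<Rightarrow> real" where
  "load P y i k = (\<Sum>j\<in>customers P. demand P j * y i k j)"

definition location_constraints ::
  "('i, 'j, 'k) clp_instance \<Rightarrow> ('i, 'k) xvar \<Rightarrow> ('i, 'j, 'k) yvar \<Rightarrow> bool" where
  "location_constraints P x y \<longleftrightarrow>
     (\<forall>j\<in>customers P. (\<Sum>i\<in>facilities P. \<Sum>k\<in>capacities P. y i k j) = 1) \<and>
     (\<forall>i\<in>facilities P. \<forall>k\<in>capacities P. \<forall>j\<in>customers P. y i k j \<le> x i k) \<and>
     (\<forall>i\<in>facilities P. (\<Sum>k\<in>capacities P. x i k) \<le> 1) \<and>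
     (\<forall>i\<in>facilities P. \<forall>k\<in>capacities P. load P y i k \<le> service_rate P i k) \<and>
     (\<forall>i\<in>facilities P. \<forall>k\<in>capacities P. x i k \<in> {0, 1}) \<and>
     (\<forall>i\<in>facilities P. \<forall>k\<in>capacities P. \<forall>j\<in>customers P. y i k j \<in> {0, 1})"

definition total_waiting ::
  "('i, 'j, 'k) clp_instance \<Rightarrow> ('i, 'j, 'k) yvar \<Rightarrow> 'i \<Rightarrow> 'k \<Rightarrow> real" where
  "total_waiting P y i k =
     (load P y i k)\<^sup>2 * (1 + (service_rate P i k)\<^sup>2 * (service_sd P i k)\<^sup>2) /
       (2 * service_rate P i k * (service_rate P i k - load P y i k))
     + load P y i k / service_rate P i k"

text \<open>The last conjunct is the stability assumption: saturated queues are infeasible.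
  In particular no denominator in \<^const>\<open>total_waiting\<close> vanishes at a feasible point
  of an instance with positive service rates.\<close>

definition clp_feasible ::
  "('i, 'j, 'k) clp_instance \<Rightarrow> ('i, 'k) xvar \<times> ('i, 'j, 'k) yvar \<Rightarrow> bool" where
  "clp_feasible P = (\<lambda>(x, y). location_constraints P x y \<and>
     (\<forall>i\<in>facilities P. \<forall>k\<in>capacities P. load P y i k \<noteq> service_rate P i k))"

definition clp_objective ::
  "('i, 'j, 'k) clp_instance \<Rightarrow> ('i, 'k) xvar \<times> ('i, 'j, 'k) yvar \<Rightarrow> real" where
  "clp_objective P = (\<lambda>(x, y).
     (\<Sum>i\<in>facilities P. \<Sum>k\<in>capacities P. fixed_cost P i k * x i k)
     + (\<Sum>i\<in>facilities P. \<Sum>k\<in>capacities P. waiting_cost P i * total_waiting P y i k)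
     + (\<Sum>i\<in>facilities P. \<Sum>k\<in>capacities P. \<Sum>j\<in>customers P.
          travel_cost P i j * demand P j * y i k j))"

definition misocp_feasible ::
  "('i, 'j, 'k) clp_instance \<Rightarrow>
   ('i, 'k) xvar \<times> ('i, 'j, 'k) yvar \<times> ('i \<Rightarrow> 'k \<Rightarrow> real) \<times> ('i \<Rightarrow> 'k \<Rightarrow> real) \<Rightarrow> bool" where
  "misocp_feasible P = (\<lambda>(x, y, s, t). location_constraints P x y \<and>
     (\<forall>i\<in>facilities P. \<forall>k\<in>capacities P.
        2 * (\<Sum>j\<in>customers P. demand P j * (y i k j)\<^sup>2) + (s i k)\<^sup>2 + (t i k)\<^sup>2
          \<le> (s i k + t i k)\<^sup>2 \<and>
        t i k = service_rate P i k - load P y i k \<and>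
        t i k \<ge> 0 \<and> s i k \<ge> 0))"

definition misocp_objective ::
  "('i, 'j, 'k) clp_instance \<Rightarrow>
   ('i, 'k) xvar \<times> ('i, 'j, 'k) yvar \<times> ('i \<Rightarrow> 'k \<Rightarrow> real) \<times> ('i \<Rightarrow> 'k \<Rightarrow> real) \<Rightarrow> real" where
  "misocp_objective P = (\<lambda>(x, y, s, t).
     (\<Sum>i\<in>facilities P. \<Sum>k\<in>capacities P. fixed_cost P i k * x i k)
     + (\<Sum>i\<in>facilities P. \<Sum>k\<in>capacities P.
          waiting_cost P i * (1 + (service_rate P i k)\<^sup>2 * (service_sd P i k)\<^sup>2) * s i k / 2
          + waiting_cost P i * (1 - (service_rate P i k)\<^sup>2 * (service_sd P i k)\<^sup>2)
              * load P y i k / (2 * service_rate P i k))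
     + (\<Sum>i\<in>facilities P. \<Sum>k\<in>capacities P. \<Sum>j\<in>customers P.
          travel_cost P i j * demand P j * y i k j))"

text \<open>The infimum is taken in the extended reals, so an infeasible problem has value \<open>\<infinity>\<close>.\<close>

definition optimal_value :: "('a \<Rightarrow> real) \<Rightarrow> ('a \<Rightarrow> bool) \<Rightarrow> ereal" where
  "optimal_value obj feas = (INF z\<in>{z. feas z}. ereal (obj z))"

end

(* For binary y we have y^2 = y, so the cone constraint says load <= s * t with t = rate - load >= 0.
   Since the rate is positive this forces t > 0, which is the stability assumption, and
   s >= load / t. The waiting term is nondecreasing in s, and it equals the M/G/1 waiting cost
   at s = load / t. *)
theory Submission
  imports Defs
begin

text \<open>The inequality in \<open>objective_proj\<close> cannot be an equality here: the
  auxiliary variable \<open>s\<close> may exceed its least feasible value. Tightness is demanded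
  only at lifted points.\<close>

locale exact_relaxation =
  fixes f :: "'a \<Rightarrow> real" and F :: "'a \<Rightarrow> bool"
    and g :: "'b \<Rightarrow> real" and G :: "'b \<Rightarrow> bool"
    and proj :: "'b \<Rightarrow> 'a" and lift :: "'a \<Rightarrow> 'b"
  assumes feasible_proj: "G z \<Longrightarrow> F (proj z)"
    and objective_proj: "G z \<Longrightarrow> f (proj z) \<le> g z"
    and feasible_lift: "F a \<Longrightarrow> G (lift a)"
    and objective_lift: "F a \<Longrightarrow> g (lift a) = f a"
    and proj_lift: "F a \<Longrightarrow> proj (lift a) = a"
begin

text \<open>Every feasible point is matched by one of the other problem that costs no more, via
  \<open>proj\<close> in one direction and \<open>lift\<close> in the other. This covers
  infeasibility: both infima are then over the empty set.\<close>

lemma optimal_value_eq: "optimal_value f F = optimal_value g G"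
  unfolding optimal_value_def
proof (rule antisym)
  show "(INF z\<in>{z. F z}. ereal (f z)) \<le> (INF z\<in>{z. G z}. ereal (g z))"
    by (rule INF_mono) (use feasible_proj objective_proj in fastforce)
  show "(INF z\<in>{z. G z}. ereal (g z)) \<le> (INF z\<in>{z. F z}. ereal (f z))"
    by (rule INF_mono) (use feasible_lift objective_lift in fastforce)
qed

text \<open>Forwards, \<open>lift a\<close> is the witness. An optimal \<open>z\<close> over
  \<open>a\<close> may differ from \<open>lift a\<close>: a zero waiting cost leaves
  \<open>s\<close> free above its bound.\<close>

lemma is_arg_min_iff: "is_arg_min f F a \<longleftrightarrow> (\<exists>z. proj z = a \<and> is_arg_min g G z)"
proof
  assume a: "is_arg_min f F a"
  then have "F a" by (simp add: is_arg_min_def)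
  have "g (lift a) \<le> g z" if "G z" for z
  proof -
    have "f a \<le> f (proj z)"
      using a feasible_proj[OF that] by (simp add: is_arg_min_linorder)
    then show ?thesis
      using objective_proj[OF that] objective_lift[OF \<open>F a\<close>] by simp
  qed
  then have "is_arg_min g G (lift a)"
    using feasible_lift[OF \<open>F a\<close>] by (simp add: is_arg_min_linorder)
  with \<open>F a\<close> show "\<exists>z. proj z = a \<and> is_arg_min g G z"
    using proj_lift by blast
next
  assume "\<exists>z. proj z = a \<and> is_arg_min g G z"
  then obtain z where z: "proj z = a" "G z" and min: "\<And>b. G b \<Longrightarrow> g z \<le> g b"
    by (auto simp: is_arg_min_linorder)
  \<comment> \<open>The chain is \<open>f (proj z)\<close> \<le> \<open>g z\<close> \<le>
    \<open>g (lift b)\<close> = \<open>f b\<close>.\<close>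
  have "f a \<le> f b" if "F b" for b
    using objective_proj[OF z(2)] min[OF feasible_lift[OF that]] objective_lift[OF that] z(1)
    by simp
  with z show "is_arg_min f F a"
    using feasible_proj by (auto simp: is_arg_min_linorder)
qed

end

text \<open>Expanding the right side cancels both squares and leaves the cross term
  \<open>2 * s * t\<close>.\<close>

lemma cone_iff_load_le:
  assumes "\<forall>j\<in>customers P. y i k j \<in> {0, 1}"
  shows "2 * (\<Sum>j\<in>customers P. demand P j * (y i k j)\<^sup>2) + s\<^sup>2 + t\<^sup>2 \<le> (s + t)\<^sup>2
    \<longleftrightarrow> load P y i k \<le> s * t"
proof -
  have "(\<Sum>j\<in>customers P. demand P j * (y i k j)\<^sup>2) = load P y i k"
    unfolding load_def using assms by (intro sum.cong) auto
  then show ?thesis by (simp add: power2_sum)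
qed

lemma load_nonneg:
  assumes "\<And>j. j \<in> customers P \<Longrightarrow> demand P j \<ge> 0"
    and "\<forall>j\<in>customers P. y i k j \<in> {0, 1}"
  shows "load P y i k \<ge> 0"
  unfolding load_def using assms by (intro sum_nonneg) fastforce

text \<open>The least \<open>s\<close> that the cone constraint admits at a stable queue; it is the
  mean number in an M/M/1 system. At saturation, division by zero makes it 0, so it does not encode
  stability by itself.\<close>

definition queue_ratio ::
  "('i, 'j, 'k) clp_instance \<Rightarrow> ('i, 'j, 'k) yvar \<Rightarrow> 'i \<Rightarrow> 'k \<Rightarrow> real" where
  "queue_ratio P y i k = load P y i k / (service_rate P i k - load P y i k)"

text \<open>With load l, rate m and c = m^2 * sd^2, use l/(m-l) = l^2/(m(m-l)) + l/m. The factor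
  (1+c)/2 then yields the queueing term plus (1+c)l/(2m), and (1-c)l/(2m) completes the latter to
  l/m.\<close>

lemma waiting_term_queue_ratio:
  assumes "service_rate P i k > 0" and "load P y i k \<noteq> service_rate P i k"
  shows "waiting_cost P i * (1 + (service_rate P i k)\<^sup>2 * (service_sd P i k)\<^sup>2)
          * queue_ratio P y i k / 2
       + waiting_cost P i * (1 - (service_rate P i k)\<^sup>2 * (service_sd P i k)\<^sup>2)
          * load P y i k / (2 * service_rate P i k)
    = waiting_cost P i * total_waiting P y i k"
proof -
  have identity: "w * (1 + c) * (l / (m - l)) / 2 + w * (1 - c) * l / (2 * m)
      = w * (l\<^sup>2 * (1 + c) / (2 * m * (m - l)) + l / m)"
    if "m > 0" "l \<noteq> m" for w c l m :: real
  proof -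
    have "m \<noteq> 0" "m - l \<noteq> 0" using that by auto
    then show ?thesis
      by (simp add: divide_simps) (simp add: algebra_simps power2_eq_square)
  qed
  show ?thesis
    unfolding total_waiting_def queue_ratio_def by (rule identity[OF assms])
qed

text \<open>Describes the fibre over each feasible \<open>(x, y)\<close>: \<open>t\<close> is
  determined and each \<open>s i k\<close> ranges over a half-line starting at
  \<open>queue_ratio\<close>.\<close>

lemma misocp_feasible_iff:
  assumes "\<And>i k. i \<in> facilities P \<Longrightarrow> k \<in> capacities P \<Longrightarrow> service_rate P i k > 0"
    and "\<And>j. j \<in> customers P \<Longrightarrow> demand P j \<ge> 0"
  shows "misocp_feasible P (x, y, s, t) \<longleftrightarrow> clp_feasible P (x, y) \<and>
    (\<forall>i\<in>facilities P. \<forall>k\<in>capacities P.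
       t i k = service_rate P i k - load P y i k \<and> queue_ratio P y i k \<le> s i k)"
proof (cases "location_constraints P x y")
  case True
  have "2 * (\<Sum>j\<in>customers P. demand P j * (y i k j)\<^sup>2) + (s i k)\<^sup>2 + (t i k)\<^sup>2
          \<le> (s i k + t i k)\<^sup>2 \<and>
        t i k = service_rate P i k - load P y i k \<and> t i k \<ge> 0 \<and> s i k \<ge> 0
    \<longleftrightarrow> load P y i k \<noteq> service_rate P i k \<and>
        t i k = service_rate P i k - load P y i k \<and> queue_ratio P y i k \<le> s i k"
    if ik: "i \<in> facilities P" "k \<in> capacities P" for i k
  proof -
    have bin: "\<forall>j\<in>customers P. y i k j \<in> {0, 1}" and le: "load P y i k \<le> service_rate P i k"
      using True ik by (auto simp: location_constraints_def)
    note cone = cone_iff_load_le[of P y i k, OF bin]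
    have nonneg: "load P y i k \<ge> 0"
      using assms(2) bin by (rule load_nonneg)
    show ?thesis
    proof (cases "load P y i k = service_rate P i k")
      \<comment> \<open>Both sides are false: \<open>t i k\<close> = 0 turns the cone constraint
        into load \<le> 0, while the load equals a positive rate.\<close>
      case True
      then show ?thesis
        using assms(1)[OF ik] by (auto simp: cone)
    next
      case False
      then have pos: "service_rate P i k - load P y i k > 0" using le by simp
      \<comment> \<open>Supplies \<open>s i k \<ge> 0\<close> in the backward direction.\<close>
      have "queue_ratio P y i k \<ge> 0"
        unfolding queue_ratio_def using nonneg pos by simp
      moreover have "queue_ratio P y i k \<le> s i k \<longleftrightarrow>
          load P y i k \<le> s i k * (service_rate P i k - load P y i k)"
        unfolding queue_ratio_def using pos by (rule pos_divide_le_eq)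
      ultimately show ?thesis
        using False pos by (auto simp: cone)
    qed
  qed
  with True show ?thesis
    by (auto simp: misocp_feasible_def clp_feasible_def)
qed (simp add: misocp_feasible_def clp_feasible_def)

lemma misocp_objective_queue_ratio:
  assumes "\<And>i k. i \<in> facilities P \<Longrightarrow> k \<in> capacities P \<Longrightarrow> service_rate P i k > 0"
    and "clp_feasible P (x, y)"
  shows "misocp_objective P (x, y, queue_ratio P y, t) = clp_objective P (x, y)"
proof -
  have "load P y i k \<noteq> service_rate P i k"
    if "i \<in> facilities P" "k \<in> capacities P" for i k
    using assms(2) that by (simp add: clp_feasible_def)
  then show ?thesis
    unfolding misocp_objective_def clp_objective_def
    by (simp add: waiting_term_queue_ratio assms(1) cong: sum.cong)
qed

text \<open>The coefficient of \<open>s i k\<close> is nonnegative; the factor 1 - m^2 * sd^2, whose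
  sign is open, multiplies only the load. The objective does not read \<open>t\<close>, so
  \<open>t\<close> and \<open>t'\<close> may differ.\<close>

lemma misocp_objective_mono:
  assumes "\<And>i. i \<in> facilities P \<Longrightarrow> waiting_cost P i \<ge> 0"
    and "\<And>i k. i \<in> facilities P \<Longrightarrow> k \<in> capacities P \<Longrightarrow> s i k \<le> s' i k"
  shows "misocp_objective P (x, y, s, t) \<le> misocp_objective P (x, y, s', t')"
  unfolding misocp_objective_def prod.case
  by (intro add_mono order_refl sum_mono divide_right_mono mult_left_mono
      mult_nonneg_nonneg add_nonneg_nonneg) (use assms in auto)

theorem mainTheorem4:
  fixes P :: "('i, 'j, 'k) clp_instance"
  assumes "finite (facilities P)" and "finite (customers P)" and "finite (capacities P)"
    and "\<And>j. j \<in> customers P \<Longrightarrow> demand P j \<ge> 0"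
    and "\<And>i k. i \<in> facilities P \<Longrightarrow> k \<in> capacities P \<Longrightarrow> service_rate P i k > 0"
    and "\<And>i k. i \<in> facilities P \<Longrightarrow> k \<in> capacities P \<Longrightarrow> service_sd P i k \<ge> 0"
    and "\<And>i. i \<in> facilities P \<Longrightarrow> waiting_cost P i \<ge> 0"
  shows "optimal_value (clp_objective P) (clp_feasible P)
           = optimal_value (misocp_objective P) (misocp_feasible P)
       \<and> (\<forall>x y. is_arg_min (clp_objective P) (clp_feasible P) (x, y) \<longleftrightarrow>
            (\<exists>s t. is_arg_min (misocp_objective P) (misocp_feasible P) (x, y, s, t)))"
proof -
  note feasible_iff = misocp_feasible_iff[OF assms(5) assms(4)]
  note objective_eq = misocp_objective_queue_ratio[OF assms(5)]
  \<comment> \<open>The lift takes the least feasible \<open>s\<close> and the forced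
    \<open>t\<close>.\<close>
  interpret exact_relaxation "clp_objective P" "clp_feasible P"
    "misocp_objective P" "misocp_feasible P"
    "\<lambda>(x, y, s, t). (x, y)"
    "\<lambda>(x, y). (x, y, queue_ratio P y, \<lambda>i k. service_rate P i k - load P y i k)"
  proof (unfold_locales, goal_cases)
    \<comment> \<open>This is \<open>objective_proj\<close>: lowering \<open>s\<close> to
      \<open>queue_ratio\<close> does not raise the cost and reaches the congested
      objective.\<close>
    case (2 z)
    obtain x y s t where z: "z = (x, y, s, t)" by (cases z)
    have feas: "clp_feasible P (x, y)"
      and s: "\<And>i k. i \<in> facilities P \<Longrightarrow> k \<in> capacities P \<Longrightarrow> queue_ratio P y i k \<le> s i k"
      using 2 by (auto simp: z feasible_iff)
    have "clp_objective P (x, y) = misocp_objective P (x, y, queue_ratio P y, t)"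
      using objective_eq[OF _ _ feas] by simp
    also have "\<dots> \<le> misocp_objective P (x, y, s, t)"
      using assms(7) s by (rule misocp_objective_mono)
    finally show ?case by (simp add: z)
  qed (auto simp: feasible_iff objective_eq)
  show ?thesis
    using optimal_value_eq by (auto simp: is_arg_min_iff)
qed

end
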